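(* Let $(u,p)\in C^1(\mathbb R^3\times(0,T))$ be a solution of the 3D incompressible Euler equations $$u_t+u\cdot\nabla u=-\nabla p,\qquad\nabla\cdot u=0$$ on $\mathbb R^3\times(0,T)$, and let $S,P,\omega,\xi,\zeta,\alpha,\rho$ and the material derivative $D_t$ be as defined in the context. Then the following identities hold on $\mathbb R^3\times(0,T)$ (at all points where the direction vectors occurring in them are defined, i.e. where $\omega\ne0$ for those involving $\xi$, and where $S\omega\neq0$ for those involving $\zeta$): $$D_t|S\omega|=-\zeta\cdot P\omega,$$ $$D_t^2\log|\omega|=|S\xi|^2-2\alpha^2-\rho,$$ $$(D_t|\omega|)^2+(|D_t\xi||\omega|)^2=|S\omega|^2,$$ $$(D_t|S\omega|)^2+(|D_t\zeta||S\omega|)^2=|P\omega|^2,$$ $$(D_t|S\omega|)^2+(|D_t\zeta|\,D_t|\omega|)^2+(|D_t\zeta||D_t\xi||\omega|)^2=|P\omega|^2.$$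
   Context: Here $u=(u_1,u_2,u_3)$ is the velocity and $p$ the scalar pressure. Notation: $S=(S_{ij})$ with $S_{ij}=\frac12(\partial_iu_j+\partial_ju_i)$; $P=(P_{ij})$ with $P_{ij}=\partial_i\partial_jp$ (Hessian of the pressure in the space variables, understood to exist as a continuous matrix-valued function); $\omega=\nabla\times u$. The direction vectors are $\xi=\omega/|\omega|$ and $\zeta=S\xi/|S\xi|=S\omega/|S\omega|$, and $\alpha=S_{ij}\xi_i\xi_j$, $\rho=P_{ij}\xi_i\xi_j$ (summation over repeated indices). The material derivative is $D_tf=\partial_tf+u\cdot\nabla f$; it is the derivative along particle trajectories, $(D_tf)(X(a,t),t)=\frac{\partial}{\partial t}\{f(X(a,t),t)\}$, where $\frac{\partial X(a,t)}{\partial t}=u(X(a,t),t)$, and this is how $D_t$ is understood for functions such as $\omega$, $S\omega$, $\xi$, $\zeta$ that need not be classically differentiable in $x$ and $t$ separately. *)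

theory Defs
  imports "HOL-Analysis.Analysis"
begin

text \<open>Space-time points are pairs (x, t); a field on space-time takes such a pair as its argument.\<close>

type_synonym point = "(real^3) \<times> real"

definition spacetime :: "real \<Rightarrow> point set" where
  "spacetime T = UNIV \<times> {0<..<T}"

definition C1_on :: "'a::real_normed_vector set \<Rightarrow> ('a \<Rightarrow> 'b::real_normed_vector) \<Rightarrow> bool" where
  "C1_on A f \<longleftrightarrow>
     (\<exists>f' :: 'a \<Rightarrow> 'a \<Rightarrow>\<^sub>L 'b.
        (\<forall>z\<in>A. (f has_derivative blinfun_apply (f' z)) (at z)) \<and> continuous_on A f')"

definition space_partial :: "3 \<Rightarrow> (point \<Rightarrow> 'b::real_normed_vector) \<Rightarrow> point \<Rightarrow> 'b" where
  "space_partial i f = (\<lambda>(x, t). vector_derivative (\<lambda>h. f (x + h *\<^sub>R axis i 1, t)) (at 0))"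

definition time_partial :: "(point \<Rightarrow> 'b::real_normed_vector) \<Rightarrow> point \<Rightarrow> 'b" where
  "time_partial f = (\<lambda>(x, t). vector_derivative (\<lambda>s. f (x, s)) (at t))"

definition gradient :: "(point \<Rightarrow> real) \<Rightarrow> point \<Rightarrow> real^3" where
  "gradient f z = (\<chi> i. space_partial i f z)"

definition divergence :: "(point \<Rightarrow> real^3) \<Rightarrow> point \<Rightarrow> real" where
  "divergence u z = (\<Sum>i\<in>UNIV. space_partial i (\<lambda>w. u w $ i) z)"

definition curl :: "(point \<Rightarrow> real^3) \<Rightarrow> point \<Rightarrow> real^3" where
  "curl u z =
     vector [space_partial 2 (\<lambda>w. u w $ 3) z - space_partial 3 (\<lambda>w. u w $ 2) z,
             space_partial 3 (\<lambda>w. u w $ 1) z - space_partial 1 (\<lambda>w. u w $ 3) z,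
             space_partial 1 (\<lambda>w. u w $ 2) z - space_partial 2 (\<lambda>w. u w $ 1) z]"

definition hessian :: "(point \<Rightarrow> real) \<Rightarrow> point \<Rightarrow> real^3^3" where
  "hessian p z = (\<chi> i j. space_partial i (space_partial j p) z)"

text \<open>The differentiability clause is needed because \<^const>\<open>space_partial\<close> is total.\<close>

definition continuous_hessian_on :: "point set \<Rightarrow> (point \<Rightarrow> real) \<Rightarrow> bool" where
  "continuous_hessian_on A p \<longleftrightarrow>
     (\<forall>(x, t)\<in>A. \<forall>i j. (\<lambda>h. space_partial j p (x + h *\<^sub>R axis i 1, t)) differentiable (at 0)) \<and>
     continuous_on A (hessian p)"

definition euler_solution :: "real \<Rightarrow> (point \<Rightarrow> real^3) \<Rightarrow> (point \<Rightarrow> real) \<Rightarrow> bool" where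
  "euler_solution T u p \<longleftrightarrow>
     (\<forall>z\<in>spacetime T.
        time_partial u z + (\<Sum>i\<in>UNIV. (u z $ i) *\<^sub>R space_partial i u z) = - gradient p z \<and>
        divergence u z = 0)"

definition strain :: "(point \<Rightarrow> real^3) \<Rightarrow> point \<Rightarrow> real^3^3" where
  "strain u z =
     (\<chi> i j. (space_partial i (\<lambda>w. u w $ j) z + space_partial j (\<lambda>w. u w $ i) z) / 2)"

text \<open>Since 0 has inverse 0, the two directions below take the value 0 where they are undefined.\<close>

definition vort_dir :: "(point \<Rightarrow> real^3) \<Rightarrow> point \<Rightarrow> real^3" where
  "vort_dir u z = curl u z /\<^sub>R norm (curl u z)"

definition stretch_dir :: "(point \<Rightarrow> real^3) \<Rightarrow> point \<Rightarrow> real^3" where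
  "stretch_dir u z = (strain u z *v vort_dir u z) /\<^sub>R norm (strain u z *v vort_dir u z)"

definition stretch_rate :: "(point \<Rightarrow> real^3) \<Rightarrow> point \<Rightarrow> real" where
  "stretch_rate u z =
     (\<Sum>i\<in>UNIV. \<Sum>j\<in>UNIV. strain u z $ i $ j * vort_dir u z $ i * vort_dir u z $ j)"

definition pressure_rate :: "(point \<Rightarrow> real^3) \<Rightarrow> (point \<Rightarrow> real) \<Rightarrow> point \<Rightarrow> real" where
  "pressure_rate u p z =
     (\<Sum>i\<in>UNIV. \<Sum>j\<in>UNIV. hessian p z $ i $ j * vort_dir u z $ i * vort_dir u z $ j)"

text \<open>
  A particle trajectory through (x, t) is required to solve the trajectory equation only for
  times near t: a velocity field that is merely C1 need not have trajectories on all of (0, T).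
\<close>

definition trajectory_through :: "(point \<Rightarrow> real^3) \<Rightarrow> point \<Rightarrow> (real \<Rightarrow> real^3) \<Rightarrow> bool" where
  "trajectory_through u = (\<lambda>(x, t) X.
     X t = x \<and> (\<forall>\<^sub>F s in nhds t. (X has_vector_derivative u (X s, s)) (at s)))"

text \<open>
  Existence of a trajectory is part of the following notion, so that it never holds vacuously.
\<close>

definition has_material_deriv ::
  "(point \<Rightarrow> real^3) \<Rightarrow> (point \<Rightarrow> 'b::real_normed_vector) \<Rightarrow> 'b \<Rightarrow> point \<Rightarrow> bool" where
  "has_material_deriv u f D z \<longleftrightarrow>
     (\<exists>X. trajectory_through u z X) \<and>
     (\<forall>X. trajectory_through u z X \<longrightarrow>
        ((\<lambda>s. f (X s, s)) has_vector_derivative D) (at (snd z)))"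

definition materially_differentiable ::
  "(point \<Rightarrow> real^3) \<Rightarrow> (point \<Rightarrow> 'b::real_normed_vector) \<Rightarrow> point \<Rightarrow> bool" where
  "materially_differentiable u f z \<longleftrightarrow> (\<exists>D. has_material_deriv u f D z)"

definition material_deriv ::
  "(point \<Rightarrow> real^3) \<Rightarrow> (point \<Rightarrow> 'b::real_normed_vector) \<Rightarrow> point \<Rightarrow> 'b" where
  "material_deriv u f z = (THE D. has_material_deriv u f D z)"

lemma material_deriv_eqI:
  assumes "has_material_deriv u f D z"
  shows "material_deriv u f z = D"
  unfolding material_deriv_def
proof (rule the_equality)
  show "has_material_deriv u f D z" by fact
  fix D' assume "has_material_deriv u f D' z"
  with assms show "D' = D"
    unfolding has_material_deriv_def by (blast intro: vector_derivative_unique_at)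
qed

end

theory Submission
  imports Defs
begin

text \<open>
  Everything follows from two transport identities along particle trajectories, D_t omega = S omega
  and D_t (S omega) = - P omega. Both are algebraic consequences of the equation
  D_t (d_i u) = - d_i (grad p) - sum_k (d_i u_k) d_k u for the velocity gradient, the
  incompressibility and the symmetry of P. For C1 velocities that equation is obtained without
  the flow map: along one trajectory X the difference quotients (u(X + h e_i, s) - u(X, s)) / h have
  time derivatives which, by the Euler equations, converge uniformly as h tends to 0. The
  identities for norms and directions are then Pythagoras' theorem for the radial and
  tangential parts of the derivative of a nonvanishing vector.
\<close>

text \<open>The obstacle is regularity: for u merely C1 the gradient of u is only continuous, so the
  Euler equations cannot be differentiated in space and u . grad (d_i u) has no classical meaning.
  Differences are exact, however. A trajectory X shifted by eta e_i is no longer a trajectory, yet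
  it moves with velocity u(X, s), which misses the local velocity by exactly u(X + eta e_i, s) -
  u(X, s) = eta Q. Hence Q' = - R - Du (Q, 0), where R is the difference quotient of grad p and Du
  is taken at the shifted point. Each ingredient on the right has a uniform limit on compact time
  intervals: Q and R by the mean value inequality and continuity of d_i u and of P, and Du by
  uniform continuity. Two classical facts have to be supplied at this level of regularity. Material
  differentiability includes the existence of a trajectory, which calls for a Picard iteration; and
  P is given only as continuous iterated space partials, so its symmetry is Schwarz's
  theorem.\<close>

section \<open>Calculus in one and two real variables: Schwarz's theorem and uniform difference
  quotients\<close>

text \<open>The second difference of f over a square of side h at (a, b) equals h^2 times a value of
  \<open>fxy\<close> in the square, and also h^2 times a value of \<open>fyx\<close> there, by
  applying the mean value theorem twice in either order. Continuity at (a, b) carries the equality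
  to the corner as h shrinks.\<close>

lemma mixed_partials_commute:
  fixes f :: "real \<Rightarrow> real \<Rightarrow> real"
  assumes fx: "\<And>x y. ((\<lambda>x. f x y) has_real_derivative fx x y) (at x)"
    and fy: "\<And>x y. (f x has_real_derivative fy x y) (at y)"
    and fxy: "\<And>x y. (fx x has_real_derivative fxy x y) (at y)"
    and fyx: "\<And>x y. ((\<lambda>x. fy x y) has_real_derivative fyx x y) (at x)"
    and cxy: "isCont (\<lambda>(x, y). fxy x y) (a, b)"
    and cyx: "isCont (\<lambda>(x, y). fyx x y) (a, b)"
  shows "fxy a b = fyx a b"
proof -
  have step: "\<exists>s t s' t'. s \<in> {a..a+h} \<and> t \<in> {b..b+h} \<and> s' \<in> {a..a+h} \<and> t' \<in> {b..b+h} \<and>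
      fxy s t = fyx s' t'" if h: "h > 0" for h
  proof -
    have "\<exists>s>a. s < a + h \<and> (f (a+h) (b+h) - f (a+h) b) - (f a (b+h) - f a b)
        = (a + h - a) * (fx s (b+h) - fx s b)"
      by (rule MVT2) (use h in \<open>auto intro!: derivative_eq_intros fx\<close>)
    then obtain s where s: "s > a" "s < a + h"
      "(f (a+h) (b+h) - f (a+h) b) - (f a (b+h) - f a b) = h * (fx s (b+h) - fx s b)" by auto
    have "\<exists>t>b. t < b + h \<and> fx s (b+h) - fx s b = (b + h - b) * fxy s t"
      by (rule MVT2) (use h in \<open>auto intro!: fxy\<close>)
    then obtain t where t: "t > b" "t < b + h" "fx s (b+h) - fx s b = h * fxy s t" by auto
    \<comment> \<open>The same second difference, now grouped by columns instead of rows.\<close>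
    have "\<exists>t'>b. t' < b + h \<and> (f (a+h) (b+h) - f a (b+h)) - (f (a+h) b - f a b)
        = (b + h - b) * (fy (a+h) t' - fy a t')"
      by (rule MVT2) (use h in \<open>auto intro!: derivative_eq_intros fy\<close>)
    then obtain t' where t': "t' > b" "t' < b + h"
      "(f (a+h) (b+h) - f a (b+h)) - (f (a+h) b - f a b) = h * (fy (a+h) t' - fy a t')" by auto
    have "\<exists>s'>a. s' < a + h \<and> fy (a+h) t' - fy a t' = (a + h - a) * fyx s' t'"
      by (rule MVT2) (use h in \<open>auto intro!: fyx\<close>)
    then obtain s' where s': "s' > a" "s' < a + h" "fy (a+h) t' - fy a t' = h * fyx s' t'" by auto
    have "h * (h * fxy s t) = h * (h * fyx s' t')"
      using s(3)[unfolded t(3)] t'(3)[unfolded s'(3)] by linarith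
    then have "fxy s t = fyx s' t'" using h by simp
    then show ?thesis using s t s' t' by (intro exI[of _ s] exI[of _ t] exI[of _ s'] exI[of _ t']) auto
  qed
  have near: "\<exists>h>0. \<forall>s\<in>{a..a+h}. \<forall>t\<in>{b..b+h}. dist (g s t) (g a b) < e"
    if g: "isCont (\<lambda>(x, y). g x y) (a, b)" and e: "e > 0" for g :: "real \<Rightarrow> real \<Rightarrow> real" and e
  proof -
    obtain d where d: "d > 0" "\<And>z. dist z (a, b) < d \<Longrightarrow> dist ((\<lambda>(x, y). g x y) z) (g a b) < e"
      using g e unfolding continuous_at_eps_delta by fastforce
    have "dist (s, t) (a, b) < d" if "s \<in> {a..a+d/3}" "t \<in> {b..b+d/3}" for s t
    proof -
      have "dist (s, t) (a, b) \<le> \<bar>s - a\<bar> + \<bar>t - b\<bar>"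
        unfolding dist_norm using norm_Pair_le[of "s - a" "t - b"] by simp
      also have "\<dots> < d" using that d(1) by auto
      finally show ?thesis .
    qed
    then show ?thesis using d by (intro exI[of _ "d/3"]) force
  qed
  show ?thesis
  proof (rule ccontr)
    assume "fxy a b \<noteq> fyx a b"
    then have e: "dist (fxy a b) (fyx a b) / 2 > 0" (is "?e > 0") by simp
    obtain h where h: "h > 0" "\<And>s t. s \<in> {a..a+h} \<Longrightarrow> t \<in> {b..b+h} \<Longrightarrow> dist (fxy s t) (fxy a b) < ?e"
      using near[OF cxy e] by blast
    obtain k where k: "k > 0" "\<And>s t. s \<in> {a..a+k} \<Longrightarrow> t \<in> {b..b+k} \<Longrightarrow> dist (fyx s t) (fyx a b) < ?e"
      using near[OF cyx e] by blast
    have "min h k > 0" using h k by simp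
    from step[OF this] obtain s t s' t' where
      "s \<in> {a..a+min h k}" "t \<in> {b..b+min h k}" "s' \<in> {a..a+min h k}" "t' \<in> {b..b+min h k}"
      and eq: "fxy s t = fyx s' t'" by blast
    then have "dist (fxy s t) (fxy a b) < ?e" "dist (fxy s t) (fyx a b) < ?e"
      using h(2)[of s t] k(2)[of s' t'] by auto
    then show False
      using dist_triangle[of "fxy a b" "fyx a b" "fxy s t"] by (simp add: dist_commute)
  qed
qed

text \<open>The interval [-1, 1] merely serves as a compact neighbourhood of 0, so that h is
  uniformly continuous on the product with I.\<close>

lemma uniform_limit_at_0_of_continuous:
  fixes h :: "real \<times> 'a::metric_space \<Rightarrow> 'b::metric_space"
  assumes "compact I" "continuous_on ({-1..1} \<times> I) h"
  shows "uniform_limit I (\<lambda>\<eta> s. h (\<eta>, s)) (\<lambda>s. h (0, s)) (at 0)"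
proof (rule uniform_limitI)
  fix e :: real assume "e > 0"
  have "uniformly_continuous_on ({-1..1} \<times> I) h"
    using assms by (intro compact_uniformly_continuous compact_Times) auto
  then obtain d where d: "d > 0"
    "\<And>z z'. z \<in> {-1..1} \<times> I \<Longrightarrow> z' \<in> {-1..1} \<times> I \<Longrightarrow> dist z' z < d \<Longrightarrow> dist (h z') (h z) < e"
    unfolding uniformly_continuous_on_def using \<open>e > 0\<close> by meson
  have "\<forall>\<^sub>F \<eta> in at (0::real). dist \<eta> 0 < min d 1"
    using d(1) by (auto simp: eventually_at intro!: exI[of _ "min d 1"])
  then show "\<forall>\<^sub>F \<eta> in at 0. \<forall>s\<in>I. dist (h (\<eta>, s)) (h (0, s)) < e"
  proof eventually_elim
    case (elim \<eta>)
    then show ?case by (auto intro!: d(2) simp: dist_Pair_Pair)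
  qed
qed

text \<open>By the mean value inequality the error of the quotient is at most the largest deviation
  of \<psi> from its value at 0 on the segment from 0 to \<eta>, and this is small uniformly in s by
  the preceding lemma.\<close>

lemma uniform_limit_difference_quotient:
  fixes \<phi> :: "real \<Rightarrow> 'a::metric_space \<Rightarrow> 'b::real_normed_vector"
  assumes "compact I" and cont: "continuous_on ({-1..1} \<times> I) (\<lambda>(\<eta>, s). \<psi> \<eta> s)"
    and der: "\<And>\<eta> s. \<bar>\<eta>\<bar> \<le> 1 \<Longrightarrow> s \<in> I \<Longrightarrow> ((\<lambda>\<eta>. \<phi> \<eta> s) has_vector_derivative \<psi> \<eta> s) (at \<eta>)"
  shows "uniform_limit I (\<lambda>\<eta> s. (\<phi> \<eta> s - \<phi> 0 s) /\<^sub>R \<eta>) (\<psi> 0) (at 0)"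
proof (rule uniform_limitI)
  fix e :: real assume "e > 0"
  \<comment> \<open>Half of e, because the mean value inequality returns only a non-strict
    bound.\<close>
  have "\<forall>\<^sub>F \<eta> in at 0. \<forall>s\<in>I. dist (\<psi> \<eta> s) (\<psi> 0 s) < e / 2"
    using uniform_limitD[OF uniform_limit_at_0_of_continuous[OF assms(1,2)], of "e / 2"] \<open>e > 0\<close> by simp
  then obtain d where d: "d > 0" "\<And>\<eta> s. \<eta> \<noteq> 0 \<Longrightarrow> \<bar>\<eta>\<bar> < d \<Longrightarrow> s \<in> I \<Longrightarrow> dist (\<psi> \<eta> s) (\<psi> 0 s) < e / 2"
    by (auto simp: eventually_at)
  have "\<forall>\<^sub>F \<eta> in at (0::real). \<eta> \<noteq> 0 \<and> dist \<eta> 0 < min d 1"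
    using d(1) by (auto simp: eventually_at intro!: exI[of _ "min d 1"])
  then show "\<forall>\<^sub>F \<eta> in at 0. \<forall>s\<in>I. dist ((\<phi> \<eta> s - \<phi> 0 s) /\<^sub>R \<eta>) (\<psi> 0 s) < e"
  proof eventually_elim
    case (elim \<eta>)
    show ?case
    proof
      fix s assume s: "s \<in> I"
      have sub: "\<bar>x\<bar> \<le> \<bar>\<eta>\<bar>" if "x \<in> closed_segment 0 \<eta>" for x
        using that by (auto simp: closed_segment_eq_real_ivl split: if_splits)
      have "norm (\<phi> \<eta> s - \<phi> 0 s - (\<eta> - 0) *\<^sub>R \<psi> 0 s) \<le> norm (\<eta> - 0) * (e / 2)"
      proof (rule vector_differentiable_bound_linearization[where S = "closed_segment 0 \<eta>" and f' = "\<lambda>x. \<psi> x s"])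
        show "norm (\<psi> x s - \<psi> 0 s) \<le> e / 2" if "x \<in> closed_segment 0 \<eta>" for x
          using d(2)[of x s] sub[OF that] elim s \<open>e > 0\<close> by (cases "x = 0") (auto simp: dist_norm)
        show "((\<lambda>\<eta>. \<phi> \<eta> s) has_vector_derivative \<psi> x s) (at x within closed_segment 0 \<eta>)"
          if "x \<in> closed_segment 0 \<eta>" for x
          using sub[OF that] elim s by (auto intro!: has_vector_derivative_at_within[OF der])
      qed auto
      moreover have "(\<phi> \<eta> s - \<phi> 0 s) /\<^sub>R \<eta> - \<psi> 0 s = (\<phi> \<eta> s - \<phi> 0 s - \<eta> *\<^sub>R \<psi> 0 s) /\<^sub>R \<eta>"
        using elim by (simp add: scaleR_right_diff_distrib)
      ultimately have "dist ((\<phi> \<eta> s - \<phi> 0 s) /\<^sub>R \<eta>) (\<psi> 0 s) \<le> e / 2"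
        using elim by (simp add: dist_norm divide_inverse_commute[symmetric] pos_divide_le_eq mult.commute)
      then show "dist ((\<phi> \<eta> s - \<phi> 0 s) /\<^sub>R \<eta>) (\<psi> 0 s) < e" using \<open>e > 0\<close> by simp
    qed
  qed
qed

section \<open>Local existence of trajectories\<close>

text \<open>On a compact cylinder around (x, t) a C1 field is bounded by some M and Lipschitz in
  space with some constant L, so the Picard operator is a contraction for short times. The result
  has the form that \<open>trajectory_through\<close> asks for.\<close>

lemma picard_local_solution:
  fixes u :: "'a::euclidean_space \<times> real \<Rightarrow> 'a"
  assumes "open U" "(x, t) \<in> U" "C1_on U u"
  shows "\<exists>X. X t = x \<and> (\<forall>\<^sub>F s in nhds t. (X has_vector_derivative u (X s, s)) (at s))"
proof -
  obtain u' where u': "\<And>z. z \<in> U \<Longrightarrow> (u has_derivative blinfun_apply (u' z)) (at z)"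
    and cu': "continuous_on U u'"
    using assms(3) unfolding C1_on_def by blast
  obtain A B where AB: "open A" "open B" "(x, t) \<in> A \<times> B" "A \<times> B \<subseteq> U"
    using open_prod_elim[OF assms(1,2)] by metis
  obtain a b where ab: "a > 0" "cball x a \<subseteq> A" "b > 0" "cball t b \<subseteq> B"
    using AB(1-3) open_contains_cball by (metis mem_Sigma_iff)
  define K where "K = cball x a \<times> cball t b"
  have KU: "K \<subseteq> U" using ab AB unfolding K_def by blast
  have "compact K" unfolding K_def by (intro compact_Times) auto
  have cu: "continuous_on K u"
    using u' KU by (meson has_derivative_continuous continuous_at_imp_continuous_on subsetD)
  have "bounded (u ` K)" "bounded (u' ` K)"
    using \<open>compact K\<close> cu cu' KU by (auto intro!: compact_imp_bounded compact_continuous_image intro: continuous_on_subset)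
  then obtain M L where M: "M > 0" "\<And>z. z \<in> K \<Longrightarrow> norm (u z) \<le> M" and L: "L > 0" "\<And>z. z \<in> K \<Longrightarrow> norm (u' z) \<le> L"
    unfolding bounded_pos by (metis imageI)
  have lip: "norm (u (y, s) - u (y', s)) \<le> L * norm (y - y')" if "y \<in> cball x a" "y' \<in> cball x a" "s \<in> cball t b" for y y' s
  proof -
    have "norm (u (y, s) - u (y', s)) \<le> L * norm ((y, s) - (y', s))"
    proof (rule differentiable_bound[where S = K and f' = "\<lambda>z. blinfun_apply (u' z)"])
      show "convex K" unfolding K_def by (intro convex_Times) auto
      show "(u has_derivative blinfun_apply (u' z)) (at z within K)" if "z \<in> K" for z
        using that KU u' by (meson has_derivative_at_withinI subsetD)
      show "onorm (blinfun_apply (u' z)) \<le> L" if "z \<in> K" for z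
        using L(2)[OF that] by (simp add: norm_blinfun.rep_eq)
    qed (use that in \<open>auto simp: K_def\<close>)
    then show ?thesis by (simp add: norm_Pair)
  qed
  \<comment> \<open>The bound b keeps times in the cylinder, a / M keeps the iterates in the ball of
    radius a, and 1 / (2 * L) makes the contraction factor 1/2.\<close>
  define d where "d = min b (min (a / M) (1 / (2 * L)))"
  have d: "d > 0" "d \<le> b" "M * d \<le> a" "L * d \<le> 1 / 2"
  proof -
    show "d > 0" "d \<le> b" using ab M L by (auto simp: d_def)
    have "d \<le> a / M" "d \<le> 1 / (2 * L)" by (auto simp: d_def)
    then show "M * d \<le> a" "L * d \<le> 1 / 2" using M L by (auto simp: field_simps)
  qed
  define J where "J = {t - d..t + d}"
  have Jb: "s \<in> cball t b" if "s \<in> J" for s using that d by (auto simp: J_def dist_real_def)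
  have tJ: "t \<in> J" using d by (auto simp: J_def)
  \<comment> \<open>Clamping the time to J lets the Picard operator act on bounded functions on the whole line.\<close>
  define c where "c s = max (t - d) (min s (t + d))" for s
  have cJ: "c s \<in> J" for s using d by (auto simp: c_def J_def)
  have c_id: "c s = s" if "s \<in> J" for s using that by (auto simp: c_def J_def)
  define S :: "(real \<Rightarrow>\<^sub>C 'a) set" where "S = PiC UNIV (\<lambda>_. cball x a)"
  have S: "apply_bcontfun f s \<in> cball x a" if "f \<in> S" for f s
    using mem_PiCD[OF that[unfolded S_def]] by blast
  \<comment> \<open>The integral starts at the left end t - d rather than at t, so that one formula
    is differentiable on all of J; subtracting \<open>G f t\<close> later moves the base point back
    to t.\<close>
  define G where "G f s = integral {t - d..s} (\<lambda>\<tau>. u (apply_bcontfun f \<tau>, \<tau>))" for f :: "real \<Rightarrow>\<^sub>C 'a" and s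
  have dG: "(G f has_vector_derivative u (apply_bcontfun f s, s)) (at s within J)" if f: "f \<in> S" and s: "s \<in> J" for f s
    unfolding G_def J_def
  proof (rule integral_has_vector_derivative)
    show "continuous_on {t - d..t + d} (\<lambda>\<tau>. u (apply_bcontfun f \<tau>, \<tau>))"
      using S[OF f] Jb by (intro continuous_on_compose2[OF cu]) (auto intro!: continuous_intros simp: K_def J_def)
  qed (use s J_def in auto)
  have bG: "norm (G f s - G f t) \<le> M * \<bar>s - t\<bar>" if f: "f \<in> S" and s: "s \<in> J" for f s
    using S[OF f] Jb s tJ unfolding J_def real_norm_def[symmetric]
    by (intro differentiable_bound[where S = "{t - d..t + d}" and f' = "\<lambda>s h. h *\<^sub>R u (apply_bcontfun f s, s)"])
      (auto intro!: onorm_le mult_left_mono M dG[OF f, unfolded J_def has_vector_derivative_def]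
        simp: K_def mult.commute[of M])
  have lG: "norm ((G f s - G g s) - (G f t - G g t)) \<le> (L * dist f g) * \<bar>s - t\<bar>" if f: "f \<in> S" and g: "g \<in> S" and s: "s \<in> J" for f g s
  proof -
    have "norm (u (apply_bcontfun f s, s) - u (apply_bcontfun g s, s)) \<le> L * dist f g" if "s \<in> J" for s
    proof -
      have "norm (u (apply_bcontfun f s, s) - u (apply_bcontfun g s, s)) \<le> L * dist (apply_bcontfun f s) (apply_bcontfun g s)"
        using lip[of "apply_bcontfun f s" "apply_bcontfun g s" s] S f g Jb that by (auto simp: dist_norm)
      also have "\<dots> \<le> L * dist f g" using L dist_bounded by (intro mult_left_mono) auto
      finally show ?thesis .
    qed
    then show ?thesis
      using s tJ unfolding J_def real_norm_def[symmetric]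
      by (intro differentiable_bound[where S = "{t - d..t + d}" and f' = "\<lambda>s h. h *\<^sub>R (u (apply_bcontfun f s, s) - u (apply_bcontfun g s, s))"])
        (auto intro!: onorm_le mult_left_mono has_vector_derivative_diff
          dG[OF f, unfolded J_def] dG[OF g, unfolded J_def]
        simp: mult.commute[of "L * _"] has_vector_derivative_def[symmetric])
  qed
  define P where "P f = Bcontfun (\<lambda>s. x + (G f (c s) - G f t))" for f
  have P: "apply_bcontfun (P f) s = x + (G f (c s) - G f t)" and PS: "P f \<in> S" if f: "f \<in> S" for f s
  proof -
    have near: "norm (G f (c s) - G f t) \<le> a" for s
    proof -
      have "norm (G f (c s) - G f t) \<le> M * \<bar>c s - t\<bar>" by (rule bG[OF f cJ])
      also have "\<dots> \<le> M * d" using cJ[of s] M by (intro mult_left_mono) (auto simp: J_def)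
      finally show ?thesis using d by simp
    qed
    have "continuous_on J (G f)"
      using dG[OF f] by (auto simp: continuous_on_eq_continuous_within intro: has_vector_derivative_continuous)
    then have "continuous_on UNIV (\<lambda>s. x + (G f (c s) - G f t))"
      unfolding c_def using cJ[unfolded c_def]
      by (auto intro!: continuous_intros continuous_on_compose2[of J "G f" UNIV])
    moreover have "norm (x + (G f (c s) - G f t)) \<le> norm x + a" for s
      using near[of s] norm_triangle_ineq[of x "G f (c s) - G f t"] by linarith
    ultimately have "(\<lambda>s. x + (G f (c s) - G f t)) \<in> bcontfun" by (rule bcontfun_normI)
    then show eq: "apply_bcontfun (P f) s = x + (G f (c s) - G f t)" for s
      by (simp add: P_def Bcontfun_inverse)
    show "P f \<in> S" unfolding S_def
      by (rule mem_PiCI) (use near in \<open>auto simp: eq dist_norm norm_minus_commute\<close>)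
  qed
  have "\<exists>!f\<in>S. P f = f"
  proof (rule Banach_fix[where c = "1/2"])
    show "complete S" unfolding S_def complete_eq_closed by (rule closed_PiC) auto
    have "const_bcontfun x \<in> S" unfolding S_def using ab by (intro mem_PiCI) (auto simp: const_bcontfun.rep_eq)
    then show "S \<noteq> {}" by blast
    show "P ` S \<subseteq> S" using PS by blast
    fix f g assume f: "f \<in> S" and g: "g \<in> S"
    show "dist (P f) (P g) \<le> 1 / 2 * dist f g"
    proof (rule dist_bound)
      fix s
      have "dist (apply_bcontfun (P f) s) (apply_bcontfun (P g) s) = norm ((G f (c s) - G g (c s)) - (G f t - G g t))"
        by (simp add: P[OF f] P[OF g] dist_norm algebra_simps)
      also have "\<dots> \<le> (L * dist f g) * \<bar>c s - t\<bar>" by (rule lG[OF f g cJ])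
      also have "\<dots> \<le> (L * dist f g) * d"
        using cJ[of s] L by (intro mult_left_mono) (auto simp: J_def)
      also have "\<dots> = (L * d) * dist f g" by simp
      also have "\<dots> \<le> 1 / 2 * dist f g" using d by (intro mult_right_mono) auto
      finally show "dist (apply_bcontfun (P f) s) (apply_bcontfun (P g) s) \<le> 1 / 2 * dist f g" .
    qed
  qed auto
  then obtain f where f: "f \<in> S" "P f = f" by blast
  have X: "apply_bcontfun f s = x + (G f s - G f t)" if "s \<in> J" for s
    using P[OF f(1), of s] f(2) c_id[OF that] by simp
  have "(apply_bcontfun f has_vector_derivative u (apply_bcontfun f s, s)) (at s)" if s: "s \<in> {t - d<..<t + d}" for s
  proof -
    have "s \<in> J" using s by (auto simp: J_def)
    then have "((\<lambda>s. x + (G f s - G f t)) has_vector_derivative u (apply_bcontfun f s, s)) (at s within J)"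
      by (auto intro!: derivative_eq_intros dG[OF f(1)])
    then have "(apply_bcontfun f has_vector_derivative u (apply_bcontfun f s, s)) (at s within J)"
      by (rule has_vector_derivative_transform[OF \<open>s \<in> J\<close> X, rotated])
    then show ?thesis
      using s by (simp add: at_within_Icc_at J_def)
  qed
  moreover have "\<forall>\<^sub>F s in nhds t. s \<in> {t - d<..<t + d}"
    using d by (intro eventually_nhds_in_open) auto
  ultimately show ?thesis
    using X[OF tJ] by (intro exI[of _ "apply_bcontfun f"]) (auto elim: eventually_mono)
qed

section \<open>Partial derivatives, and symmetry of the pressure Hessian\<close>

lemma open_spacetime: "open (spacetime T)"
  unfolding spacetime_def by (intro open_Times) auto

lemma has_vector_derivative_axis_line:
  assumes "(f has_derivative f') (at (x + h *\<^sub>R axis i 1, t))"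
  shows "((\<lambda>h. f (x + h *\<^sub>R axis i 1, t)) has_vector_derivative f' (axis i 1, 0)) (at h)"
proof -
  have "((\<lambda>h. (x + h *\<^sub>R axis i 1, t)) has_vector_derivative (axis i 1, 0)) (at h)"
    by (auto intro!: derivative_eq_intros has_vector_derivative_Pair)
  from vector_derivative_diff_chain_within[OF this has_derivative_at_withinI[OF assms]]
  show ?thesis by (simp add: o_def)
qed

lemma space_partial_eq:
  assumes "(f has_derivative f') (at z)"
  shows "space_partial i f z = f' (axis i 1, 0)"
proof -
  obtain x t where z: "z = (x, t)" by force
  have "((\<lambda>h. f (x + h *\<^sub>R axis i 1, t)) has_vector_derivative f' (axis i 1, 0)) (at 0)"
    by (rule has_vector_derivative_axis_line) (simp add: assms flip: z)
  then show ?thesis by (simp add: z space_partial_def vector_derivative_at)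
qed

lemma time_partial_eq:
  assumes "(f has_derivative f') (at z)"
  shows "time_partial f z = f' (0, 1)"
proof -
  obtain x t where z: "z = (x, t)" by force
  have "((\<lambda>s. (x, s)) has_vector_derivative (0, 1)) (at t)"
    by (auto intro!: derivative_eq_intros has_vector_derivative_Pair)
  from vector_derivative_diff_chain_within[OF this has_derivative_at_withinI[OF assms[unfolded z]]]
  show ?thesis by (simp add: z time_partial_def vector_derivative_at o_def)
qed

text \<open>A partial derivative is a derivative at parameter 0; moving the base point along the
  line to parameter \<eta> turns it into the derivative at \<eta>.\<close>

lemma has_vector_derivative_space_partial_line:
  assumes "\<And>x. (\<lambda>h. f (x + h *\<^sub>R axis i 1, t)) differentiable (at 0)"
  shows "((\<lambda>h. f (x + h *\<^sub>R axis i 1, t)) has_vector_derivative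
    space_partial i f (x + \<eta> *\<^sub>R axis i 1, t)) (at \<eta>)"
proof -
  have "((\<lambda>h. f ((x + \<eta> *\<^sub>R axis i 1) + h *\<^sub>R axis i 1, t)) has_vector_derivative
      space_partial i f (x + \<eta> *\<^sub>R axis i 1, t)) (at (\<eta> - \<eta>))"
    using assms[of "x + \<eta> *\<^sub>R axis i 1"] by (simp add: space_partial_def vector_derivative_works)
  moreover have "((\<lambda>h. h - \<eta>) has_vector_derivative 1) (at \<eta>)"
    by (auto intro!: derivative_eq_intros)
  ultimately have "((\<lambda>h. f ((x + \<eta> *\<^sub>R axis i 1) + h *\<^sub>R axis i 1, t)) \<circ> (\<lambda>h. h - \<eta>) has_vector_derivative
      1 *\<^sub>R space_partial i f (x + \<eta> *\<^sub>R axis i 1, t)) (at \<eta>)"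
    by (intro vector_diff_chain_at)
  then show ?thesis by (simp add: o_def algebra_simps)
qed

lemma has_vector_derivative_hessian_line:
  assumes "continuous_hessian_on (spacetime T) p" "(y, t) \<in> spacetime T"
  shows "((\<lambda>h. space_partial j p (y + h *\<^sub>R axis i 1, t)) has_vector_derivative
    hessian p (y + \<eta> *\<^sub>R axis i 1, t) $ i $ j) (at \<eta>)"
  unfolding hessian_def vec_lambda_beta
proof (rule has_vector_derivative_space_partial_line)
  fix x :: "real^3"
  have "(x, t) \<in> spacetime T" using assms(2) by (simp add: spacetime_def)
  from bspec[OF assms(1)[unfolded continuous_hessian_on_def, THEN conjunct1] this]
  show "(\<lambda>h. space_partial j p (x + h *\<^sub>R axis i 1, t)) differentiable at 0" by simp
qed

text \<open>Schwarz's theorem for p restricted to the plane through x spanned by the axes i and j at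
  fixed t. The plane stays in the domain because the domain contains all of space.\<close>

lemma hessian_symmetric:
  assumes "C1_on (spacetime T) p" "continuous_hessian_on (spacetime T) p" "z \<in> spacetime T"
  shows "hessian p z $ i $ j = hessian p z $ j $ i"
proof -
  obtain x t where z: "z = (x, t)" by force
  have inT: "(y, t) \<in> spacetime T" for y using assms(3) by (simp add: z spacetime_def)
  obtain p' where p': "\<And>z. z \<in> spacetime T \<Longrightarrow> (p has_derivative blinfun_apply (p' z)) (at z)"
    using assms(1) unfolding C1_on_def by blast
  have d1: "((\<lambda>h. p (y + h *\<^sub>R axis k 1, t)) has_vector_derivative
      space_partial k p (y + \<eta> *\<^sub>R axis k 1, t)) (at \<eta>)" for y \<eta> k
    using has_vector_derivative_axis_line[OF p'[OF inT]] by (simp add: space_partial_eq[OF p'[OF inT]])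
  have d2: "((\<lambda>h. space_partial k p (y + h *\<^sub>R axis l 1, t)) has_vector_derivative
      hessian p (y + \<eta> *\<^sub>R axis l 1, t) $ l $ k) (at \<eta>)" for y \<eta> k l
    by (rule has_vector_derivative_hessian_line[OF assms(2) inT])
  have cont: "isCont (\<lambda>(a, b). hessian p (x + a *\<^sub>R axis i 1 + b *\<^sub>R axis j 1, t) $ k $ l) (0, 0)" for k l
  proof -
    have "continuous_on UNIV (\<lambda>(a, b). hessian p (x + a *\<^sub>R axis i 1 + b *\<^sub>R axis j 1, t) $ k $ l)"
      unfolding case_prod_beta
    proof (rule continuous_on_component, rule continuous_on_component,
        rule continuous_on_compose2[of "spacetime T" "hessian p"])
      show "continuous_on UNIV (\<lambda>c. (x + fst c *\<^sub>R axis i 1 + snd c *\<^sub>R axis j 1, t))"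
        by (intro continuous_intros)
    qed (use assms(2) inT in \<open>auto simp: continuous_hessian_on_def\<close>)
    then show ?thesis by (simp add: continuous_on_eq_continuous_at)
  qed
  \<comment> \<open>Brings the varying increment to the end, where the facts about axis lines expect
    it.\<close>
  have comm: "x + a *\<^sub>R axis i 1 + b *\<^sub>R axis j 1 = (x + b *\<^sub>R axis j 1) + a *\<^sub>R axis i 1" for a b
    by (simp add: algebra_simps)
  have "hessian p (x + 0 *\<^sub>R axis i 1 + 0 *\<^sub>R axis j 1, t) $ j $ i
      = hessian p (x + 0 *\<^sub>R axis i 1 + 0 *\<^sub>R axis j 1, t) $ i $ j"
  proof (rule mixed_partials_commute[where a = 0 and b = 0
        and f = "\<lambda>a b. p (x + a *\<^sub>R axis i 1 + b *\<^sub>R axis j 1, t)"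
        and fx = "\<lambda>a b. space_partial i p (x + a *\<^sub>R axis i 1 + b *\<^sub>R axis j 1, t)"
        and fy = "\<lambda>a b. space_partial j p (x + a *\<^sub>R axis i 1 + b *\<^sub>R axis j 1, t)"
        and fxy = "\<lambda>a b. hessian p (x + a *\<^sub>R axis i 1 + b *\<^sub>R axis j 1, t) $ j $ i"
        and fyx = "\<lambda>a b. hessian p (x + a *\<^sub>R axis i 1 + b *\<^sub>R axis j 1, t) $ i $ j"])
    show "((\<lambda>a. p (x + a *\<^sub>R axis i 1 + b *\<^sub>R axis j 1, t)) has_real_derivative
        space_partial i p (x + a *\<^sub>R axis i 1 + b *\<^sub>R axis j 1, t)) (at a)" for a b
      unfolding comm has_real_derivative_iff_has_vector_derivative by (rule d1)
    show "((\<lambda>b. p (x + a *\<^sub>R axis i 1 + b *\<^sub>R axis j 1, t)) has_real_derivative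
        space_partial j p (x + a *\<^sub>R axis i 1 + b *\<^sub>R axis j 1, t)) (at b)" for a b
      unfolding has_real_derivative_iff_has_vector_derivative by (rule d1)
    show "((\<lambda>b. space_partial i p (x + a *\<^sub>R axis i 1 + b *\<^sub>R axis j 1, t)) has_real_derivative
        hessian p (x + a *\<^sub>R axis i 1 + b *\<^sub>R axis j 1, t) $ j $ i) (at b)" for a b
      unfolding has_real_derivative_iff_has_vector_derivative by (rule d2)
    show "((\<lambda>a. space_partial j p (x + a *\<^sub>R axis i 1 + b *\<^sub>R axis j 1, t)) has_real_derivative
        hessian p (x + a *\<^sub>R axis i 1 + b *\<^sub>R axis j 1, t) $ i $ j) (at a)" for a b
      unfolding comm has_real_derivative_iff_has_vector_derivative by (rule d2)
  qed (fact cont)+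
  then show ?thesis by (simp add: z)
qed

section \<open>The velocity gradient along a trajectory\<close>

text \<open>\<open>Du\<close> names the derivative whose existence \<open>C1_on\<close> asserts;
  space partials and the convective derivative then become values of one linear map, at (e_i, 0) and
  at (u, 1).\<close>

locale C1_euler =
  fixes u :: "point \<Rightarrow> real^3" and p :: "point \<Rightarrow> real" and T :: real
    and Du :: "point \<Rightarrow> point \<Rightarrow>\<^sub>L (real^3)"
  assumes Du: "z \<in> spacetime T \<Longrightarrow> (u has_derivative blinfun_apply (Du z)) (at z)"
    and continuous_Du: "continuous_on (spacetime T) Du"
    and C1_p: "C1_on (spacetime T) p"
    and hessian_p: "continuous_hessian_on (spacetime T) p"
    and euler: "euler_solution T u p"
begin

lemma ex_trajectory:
  assumes "z \<in> spacetime T"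
  shows "\<exists>X. trajectory_through u z X"
proof -
  have "C1_on (spacetime T) u" using Du continuous_Du unfolding C1_on_def by blast
  from picard_local_solution[OF open_spacetime _ this, of "fst z" "snd z"] assms
  show ?thesis by (simp add: trajectory_through_def case_prod_beta)
qed

lemma space_partial_u: "z \<in> spacetime T \<Longrightarrow> space_partial i u z = Du z (axis i 1, 0)"
  by (rule space_partial_eq[OF Du])

lemma space_partial_u_component:
  assumes "z \<in> spacetime T"
  shows "space_partial i (\<lambda>w. u w $ j) z = space_partial i u z $ j"
proof -
  have "((\<lambda>w. u w $ j) has_derivative (\<lambda>h. Du z h $ j)) (at z)"
    by (rule bounded_linear.has_derivative[OF bounded_linear_vec_nth Du[OF assms]])
  then show ?thesis by (simp add: space_partial_eq space_partial_u[OF assms])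
qed

lemma Du_space:
  assumes "z \<in> spacetime T"
  shows "Du z (v, 0) = (\<Sum>k\<in>UNIV. (v $ k) *\<^sub>R space_partial k u z)"
proof -
  have "(v, 0) = (\<Sum>k\<in>UNIV. (v $ k) *\<^sub>R (axis k 1, 0::real))"
  proof -
    have "(\<Sum>k\<in>UNIV. (v $ k) *\<^sub>R (axis k 1, 0::real)) = (\<Sum>k\<in>UNIV. ((v $ k) *\<^sub>R axis k 1, 0::real))"
      by simp
    also have "\<dots> = (\<Sum>k\<in>UNIV. (v $ k) *\<^sub>R axis k 1, 0::real)"
      by (simp add: prod_eq_iff fst_sum snd_sum)
    also have "\<dots> = (v, 0)" using basis_expansion[of v] by (simp add: scalar_mult_eq_scaleR)
    finally show ?thesis by (rule sym)
  qed
  then show ?thesis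
    by (simp only: blinfun.sum_right blinfun.scaleR_right space_partial_u[OF assms])
qed

text \<open>The Euler equation as a directional derivative at a single point. In this form it also
  applies at the shifted points, which lie off the trajectory.\<close>

lemma Du_convective:
  assumes "z \<in> spacetime T"
  shows "Du z (u z, 1) = - gradient p z"
proof -
  have "Du z (u z, 1) = Du z (0, 1) + Du z (u z, 0)"
    by (simp flip: blinfun.add_right)
  also have "\<dots> = time_partial u z + (\<Sum>k\<in>UNIV. (u z $ k) *\<^sub>R space_partial k u z)"
    using time_partial_eq[OF Du[OF assms]] Du_space[OF assms] by simp
  also have "\<dots> = - gradient p z"
    using euler assms unfolding euler_solution_def by blast
  finally show ?thesis .
qed

lemma continuous_space_partial_u: "continuous_on (spacetime T) (space_partial i u)"
proof -
  have "continuous_on (spacetime T) (\<lambda>z. Du z (axis i 1, 0))"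
    by (intro continuous_intros continuous_Du)
  then show ?thesis using space_partial_u by (simp cong: continuous_on_cong)
qed

text \<open>Differentiation of limits: the quotients Q converge to d_i u along X and their time
  derivatives G converge uniformly to \<open>G0\<close>, so \<open>G0\<close> is the time derivative
  of d_i u along X.\<close>

lemma space_partial_u_along_trajectory:
  assumes z: "z \<in> spacetime T" and X: "trajectory_through u z X"
  shows "((\<lambda>s. space_partial i u (X s, s)) has_vector_derivative
    - (hessian p z $ i) - (\<Sum>k\<in>UNIV. (space_partial i u z $ k) *\<^sub>R space_partial k u z)) (at (snd z))"
proof -
  obtain x t where zxt: "z = (x, t)" by force
  have Xt: "X t = x" and ev: "\<forall>\<^sub>F s in nhds t. (X has_vector_derivative u (X s, s)) (at s)"
    using X by (auto simp: trajectory_through_def zxt)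
  have "\<forall>\<^sub>F s in nhds t. s \<in> {0<..<T}"
    using z by (intro eventually_nhds_in_open) (auto simp: zxt spacetime_def)
  with ev have "\<forall>\<^sub>F s in nhds t. s \<in> {0<..<T} \<and> (X has_vector_derivative u (X s, s)) (at s)"
    by eventually_elim simp
  then obtain d where d: "d > 0"
    "\<And>s. dist s t \<le> d \<Longrightarrow> s \<in> {0<..<T} \<and> (X has_vector_derivative u (X s, s)) (at s)"
    unfolding eventually_nhds_metric_le by blast
  \<comment> \<open>A closed interval: compactness gives the uniform limits, convexity the theorem
    on differentiating a limit.\<close>
  define I where "I = cball t d"
  have I: "compact I" "convex I" "t \<in> I" using d(1) by (auto simp: I_def)
  have dX: "(X has_vector_derivative u (X s, s)) (at s)" and IT: "s \<in> {0<..<T}" if "s \<in> I" for s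
    using d(2)[of s] that by (auto simp: I_def dist_commute)
  have inT: "(y, s) \<in> spacetime T" if "s \<in> I" for y s using IT[OF that] by (simp add: spacetime_def)
  define e where "e = (axis i 1 :: real^3)"
  \<comment> \<open>The graph of the trajectory, rigidly translated by \<eta> in direction
    i.\<close>
  define w where "w \<eta> s = (X s + \<eta> *\<^sub>R e, s)" for \<eta> s
  have w0: "w 0 s = (X s, s)" for s by (simp add: w_def)
  have wT: "w \<eta> s \<in> spacetime T" if "s \<in> I" for \<eta> s using inT[OF that] by (simp add: w_def)
  have cX: "continuous_on I X"
    using dX by (meson continuous_at_imp_continuous_on has_vector_derivative_continuous)
  have cw: "continuous_on (A \<times> I) (\<lambda>(\<eta>, s). w \<eta> s)" for A
    unfolding w_def case_prod_beta
    by (intro continuous_intros continuous_on_compose2[OF cX]) auto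
  have cg: "continuous_on (A \<times> I) (\<lambda>(\<eta>, s). g (w \<eta> s))" if "continuous_on (spacetime T) g"
    for A and g :: "point \<Rightarrow> 'c::topological_space"
    using continuous_on_compose2[OF that cw, of A] wT by (force simp: case_prod_beta)
  \<comment> \<open>A product of uniform limits needs bounded limits; this serves the term Du (Q,
    0).\<close>
  have bdd: "bounded ((\<lambda>s. g (w 0 s)) ` I)" if "continuous_on (spacetime T) g"
    for g :: "point \<Rightarrow> 'c::real_normed_vector"
  proof -
    have "continuous_on I (\<lambda>s. g (w 0 s))"
      by (rule continuous_on_compose2[OF that]) (use cX wT[of _ 0] in \<open>auto simp: w_def intro!: continuous_intros\<close>)
    then show ?thesis using I(1) by (intro compact_imp_bounded compact_continuous_image)
  qed
  have chess: "continuous_on (spacetime T) (\<lambda>z. hessian p z $ i)"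
    using hessian_p unfolding continuous_hessian_on_def by (auto intro: continuous_intros)

  define Q where "Q \<eta> s = (u (w \<eta> s) - u (w 0 s)) /\<^sub>R \<eta>" for \<eta> s
  define R where "R \<eta> s = (gradient p (w \<eta> s) - gradient p (w 0 s)) /\<^sub>R \<eta>" for \<eta> s
  have limQ: "uniform_limit I Q (\<lambda>s. space_partial i u (w 0 s)) (at 0)"
    unfolding Q_def
  proof (rule uniform_limit_difference_quotient[OF I(1), where \<phi> = "\<lambda>\<eta> s. u (w \<eta> s)"])
    show "continuous_on ({-1..1} \<times> I) (\<lambda>(\<eta>, s). space_partial i u (w \<eta> s))"
      by (rule cg[OF continuous_space_partial_u])
    show "((\<lambda>\<eta>. u (w \<eta> s)) has_vector_derivative space_partial i u (w \<eta> s)) (at \<eta>)" if "s \<in> I" for \<eta> s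
      using has_vector_derivative_axis_line[OF Du[OF inT[OF that]]] space_partial_u[OF inT[OF that]]
      by (simp add: w_def e_def)
  qed
  have limR: "uniform_limit I R (\<lambda>s. hessian p (w 0 s) $ i) (at 0)"
    unfolding R_def
  proof (rule uniform_limit_difference_quotient[OF I(1), where \<phi> = "\<lambda>\<eta> s. gradient p (w \<eta> s)"])
    show "continuous_on ({-1..1} \<times> I) (\<lambda>(\<eta>, s). hessian p (w \<eta> s) $ i)"
      by (rule cg[OF chess])
    show "((\<lambda>\<eta>. gradient p (w \<eta> s)) has_vector_derivative hessian p (w \<eta> s) $ i) (at \<eta>)" if s: "s \<in> I" for \<eta> s
    proof -
      have "((\<lambda>\<eta>. space_partial j p (w \<eta> s)) has_vector_derivative hessian p (w \<eta> s) $ i $ j) (at \<eta>)" for j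
        unfolding w_def e_def by (rule has_vector_derivative_hessian_line[OF hessian_p inT[OF s]])
      then have "((\<lambda>\<eta>. \<chi> j. space_partial j p (w \<eta> s)) has_vector_derivative (\<chi> j. hessian p (w \<eta> s) $ i $ j)) (at \<eta>)"
        unfolding has_vector_derivative_def
        by (subst has_derivative_componentwise_within) (auto simp: Basis_vec_def inner_axis)
      then show ?thesis by (simp add: gradient_def)
    qed
  qed
  have limD: "uniform_limit I (\<lambda>\<eta> s. Du (w \<eta> s)) (\<lambda>s. Du (w 0 s)) (at 0)"
    using uniform_limit_at_0_of_continuous[OF I(1) cg[OF continuous_Du]] by simp
  define G where "G \<eta> s = - R \<eta> s - Du (w \<eta> s) (Q \<eta> s, 0)" for \<eta> s
  define G0 where "G0 s = - (hessian p (w 0 s) $ i) - Du (w 0 s) (space_partial i u (w 0 s), 0)" for s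
  have limQ0: "uniform_limit I (\<lambda>\<eta> s. (Q \<eta> s, 0::real)) (\<lambda>s. (space_partial i u (w 0 s), 0)) (at 0)"
    by (rule bounded_linear.uniform_limit[OF _ limQ]) (intro bounded_linear_intros)
  have "continuous_on (spacetime T) (\<lambda>z. (space_partial i u z, 0::real))"
    by (intro continuous_intros continuous_space_partial_u)
  from bdd[OF this] have limG: "uniform_limit I G G0 (at 0)"
    unfolding G_def G0_def
    by (intro uniform_limit_intros limR limD limQ0 bdd[OF continuous_Du]
        bounded_bilinear.bounded_uniform_limit[OF bounded_bilinear_blinfun_apply])
  have dQ: "(Q \<eta> has_vector_derivative G \<eta> s) (at s)" if s: "s \<in> I" for \<eta> s
  proof -
    have *: "((\<lambda>s. u (w \<eta> s)) has_vector_derivative Du (w \<eta> s) (u (w 0 s), 1)) (at s)" for \<eta>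
    proof -
      have "((\<lambda>s. w \<eta> s) has_vector_derivative (u (w 0 s), 1)) (at s)"
        unfolding w_def using dX[OF s] by (auto intro!: derivative_eq_intros has_vector_derivative_Pair)
      from vector_derivative_diff_chain_within[OF this has_derivative_at_withinI[OF Du[OF wT[OF s]]]]
      show ?thesis by (simp add: o_def)
    qed
    \<comment> \<open>The shifted curve has velocity u at the unshifted point; replacing it by the
      local velocity produces the pressure gradient, and the difference leaves the second
      term.\<close>
    have split: "Du (w \<eta> s) (u (w 0 s), 1)
        = - gradient p (w \<eta> s) - Du (w \<eta> s) (u (w \<eta> s) - u (w 0 s), 0)"
      by (simp flip: Du_convective[OF wT[OF s]] blinfun.diff_right)
    have "((\<lambda>s. (u (w \<eta> s) - u (w 0 s)) /\<^sub>R \<eta>) has_vector_derivative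
        (Du (w \<eta> s) (u (w 0 s), 1) - Du (w 0 s) (u (w 0 s), 1)) /\<^sub>R \<eta>) (at s)"
      by (intro bounded_linear.has_vector_derivative[OF bounded_linear_scaleR_right]
          has_vector_derivative_diff *)
    moreover have "(Du (w \<eta> s) (u (w 0 s), 1) - Du (w 0 s) (u (w 0 s), 1)) /\<^sub>R \<eta> = G \<eta> s"
    proof -
      have "Du (w \<eta> s) (Q \<eta> s, 0) = Du (w \<eta> s) (u (w \<eta> s) - u (w 0 s), 0) /\<^sub>R \<eta>"
        by (simp add: Q_def flip: blinfun.scaleR_right)
      then show ?thesis
        unfolding split Du_convective[OF wT[OF s]] G_def R_def by (simp add: algebra_simps)
    qed
    ultimately show ?thesis unfolding Q_def by simp
  qed
  \<comment> \<open>The theorem on differentiating a limit speaks of sequences, so \<eta> runs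
    through 1/(n+1).\<close>
  define \<eta> where "\<eta> n = inverse (real (Suc n))" for n
  have \<eta>: "filterlim \<eta> (at 0) sequentially"
    unfolding filterlim_at \<eta>_def using LIMSEQ_inverse_real_of_nat by auto
  have "\<exists>g. \<forall>s\<in>I. (\<lambda>n. Q (\<eta> n) s) \<longlonglongrightarrow> g s \<and> (g has_derivative (\<lambda>h. h *\<^sub>R G0 s)) (at s within I)"
  proof (rule has_derivative_sequence[OF I(2)])
    show "(Q (\<eta> n) has_derivative (\<lambda>h. h *\<^sub>R G (\<eta> n) s)) (at s within I)" if "s \<in> I" for n s
      using dQ[OF that] by (auto simp: has_vector_derivative_def intro: has_derivative_at_withinI)
    fix \<epsilon> :: real assume "\<epsilon> > 0"
    from filterlim_iff[THEN iffD1, OF \<eta>, rule_format, OF uniform_limitD[OF limG this]]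
    show "\<forall>\<^sub>F n in sequentially. \<forall>s\<in>I. \<forall>h. norm (h *\<^sub>R G (\<eta> n) s - h *\<^sub>R G0 s) \<le> \<epsilon> * norm h"
    proof eventually_elim
      case (elim n)
      show ?case
      proof (intro ballI allI)
        fix s h assume "s \<in> I"
        then have "norm (G (\<eta> n) s - G0 s) \<le> \<epsilon>" using elim by (simp add: dist_norm less_imp_le)
        then show "norm (h *\<^sub>R G (\<eta> n) s - h *\<^sub>R G0 s) \<le> \<epsilon> * norm h"
          by (simp add: mult_left_mono mult.commute[of \<epsilon>] flip: scaleR_right_diff_distrib)
      qed
    qed
  next
    show "t \<in> I" by fact
    show "(\<lambda>n. Q (\<eta> n) t) \<longlonglongrightarrow> space_partial i u (w 0 t)"
      by (rule filterlim_compose[OF tendsto_uniform_limitI[OF limQ I(3)] \<eta>])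
  qed
  then obtain g where g: "\<And>s. s \<in> I \<Longrightarrow> (\<lambda>n. Q (\<eta> n) s) \<longlonglongrightarrow> g s"
    and dg: "\<And>s. s \<in> I \<Longrightarrow> (g has_vector_derivative G0 s) (at s within I)"
    unfolding has_vector_derivative_def by blast
  have "g s = space_partial i u (w 0 s)" if "s \<in> I" for s
    using LIMSEQ_unique[OF g[OF that] filterlim_compose[OF tendsto_uniform_limitI[OF limQ that] \<eta>]] .
  then have "((\<lambda>s. space_partial i u (w 0 s)) has_vector_derivative G0 t) (at t within I)"
    using has_vector_derivative_transform[OF I(3) _ dg[OF I(3)]] by metis
  moreover have "at t within I = at t"
    using d(1) by (intro at_within_interior) (simp add: I_def)
  moreover have "G0 t = - (hessian p z $ i) - (\<Sum>k\<in>UNIV. (space_partial i u z $ k) *\<^sub>R space_partial k u z)"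
    using Du_space[OF z, of "space_partial i u z"] by (simp add: G0_def w0 Xt flip: zxt)
  ultimately show ?thesis by (simp add: w0 zxt)
qed

end

section \<open>Norms, directions and logarithms along a trajectory\<close>

lemma has_vector_derivative_norm:
  fixes f :: "real \<Rightarrow> 'a::real_inner"
  assumes "(f has_vector_derivative D) (at t)" "f t \<noteq> 0"
  shows "((\<lambda>s. norm (f s)) has_vector_derivative (sgn (f t) \<bullet> D)) (at t)"
  using vector_derivative_diff_chain_within[OF assms(1) has_derivative_at_withinI[OF has_derivative_norm[OF assms(2)]]]
  by (simp add: o_def inner_commute)

text \<open>A direction changes only through the component of D orthogonal to it, divided by the
  length of the vector.\<close>

lemma has_vector_derivative_sgn:
  fixes f :: "real \<Rightarrow> 'a::real_inner"
  assumes "(f has_vector_derivative D) (at t)" "f t \<noteq> 0"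
  shows "((\<lambda>s. f s /\<^sub>R norm (f s)) has_vector_derivative
    (D - (sgn (f t) \<bullet> D) *\<^sub>R sgn (f t)) /\<^sub>R norm (f t)) (at t)"
proof -
  have "((\<lambda>s. inverse (norm (f s))) has_vector_derivative
      - (inverse (norm (f t)) * (sgn (f t) \<bullet> D) * inverse (norm (f t)))) (at t)"
    using has_vector_derivative_norm[OF assms] assms(2)
    unfolding has_real_derivative_iff_has_vector_derivative[symmetric]
    by (intro DERIV_inverse') auto
  from bounded_bilinear.has_vector_derivative[OF bounded_bilinear_scaleR this assms(1)]
  show ?thesis
    by (simp add: sgn_div_norm scaleR_right_diff_distrib mult_ac)
qed

lemma norm_sgn_derivative_pythagoras:
  fixes v D :: "'a::real_inner"
  assumes "v \<noteq> 0"
  shows "(sgn v \<bullet> D)\<^sup>2 + (norm ((D - (sgn v \<bullet> D) *\<^sub>R sgn v) /\<^sub>R norm v) * norm v)\<^sup>2 = (norm D)\<^sup>2"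
proof -
  have "sgn v \<bullet> sgn v = 1" using assms by (simp add: dot_square_norm norm_sgn)
  then have sq: "(norm (D - (sgn v \<bullet> D) *\<^sub>R sgn v))\<^sup>2 = (norm D)\<^sup>2 - (sgn v \<bullet> D)\<^sup>2"
    unfolding power2_norm_eq_inner
    by (simp add: inner_diff_left inner_diff_right inner_commute power2_eq_square)
  have eq: "norm ((D - (sgn v \<bullet> D) *\<^sub>R sgn v) /\<^sub>R norm v) * norm v = norm (D - (sgn v \<bullet> D) *\<^sub>R sgn v)"
    using assms by simp
  show ?thesis unfolding eq sq by simp
qed

text \<open>The filter is \<open>nhds\<close> because the values at t itself enter the
  derivative.\<close>

lemma has_vector_derivative_at_cong:
  assumes "\<forall>\<^sub>F s in nhds t. f s = g s"
  shows "(f has_vector_derivative D) (at t) \<longleftrightarrow> (g has_vector_derivative D) (at t)"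
  by (intro has_vector_derivative_cong_ev eventually_nhds_x_imp_x[OF assms] eventually_mono[OF assms]) simp

lemma bounded_linear_cross3: "bounded_linear (cross3 a)"
  using bilinear_cross unfolding bilinear_def by (simp add: linear_conv_bounded_linear)

lemma trajectory_through_start: "trajectory_through u z X \<Longrightarrow> (X (snd z), snd z) = z"
  by (auto simp: trajectory_through_def)

text \<open>Existence of a trajectory is inherited from f, which leaves only a chain rule on a curve
  of one variable.\<close>

lemma has_material_deriv_compose:
  assumes "has_material_deriv u f D z"
    and "\<And>X. ((\<lambda>s. f (X s, s)) has_vector_derivative D) (at (snd z)) \<Longrightarrow> (X (snd z), snd z) = z \<Longrightarrow>
      ((\<lambda>s. g (X s, s)) has_vector_derivative E) (at (snd z))"
  shows "has_material_deriv u g E z"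
  unfolding has_material_deriv_def
proof (intro conjI allI impI)
  show "\<exists>X. trajectory_through u z X" using assms(1) unfolding has_material_deriv_def by blast
  fix X assume X: "trajectory_through u z X"
  then have "((\<lambda>s. f (X s, s)) has_vector_derivative D) (at (snd z))"
    using assms(1) unfolding has_material_deriv_def by blast
  then show "((\<lambda>s. g (X s, s)) has_vector_derivative E) (at (snd z))"
    by (rule assms(2)) (rule trajectory_through_start[OF X])
qed

lemma has_material_deriv_norm:
  fixes f :: "point \<Rightarrow> 'b::real_inner"
  assumes "has_material_deriv u f D z" "f z \<noteq> 0"
  shows "has_material_deriv u (\<lambda>w. norm (f w)) (sgn (f z) \<bullet> D) z"
  using assms(1)
proof (rule has_material_deriv_compose)
  fix X assume "((\<lambda>s. f (X s, s)) has_vector_derivative D) (at (snd z))" and z: "(X (snd z), snd z) = z"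
  then show "((\<lambda>s. norm (f (X s, s))) has_vector_derivative (sgn (f z) \<bullet> D)) (at (snd z))"
    using has_vector_derivative_norm[of "\<lambda>s. f (X s, s)" D "snd z", unfolded z, OF _ assms(2)] by blast
qed

lemma has_material_deriv_sgn:
  fixes f :: "point \<Rightarrow> 'b::real_inner"
  assumes "has_material_deriv u f D z" "f z \<noteq> 0"
  shows "has_material_deriv u (\<lambda>w. f w /\<^sub>R norm (f w))
    ((D - (sgn (f z) \<bullet> D) *\<^sub>R sgn (f z)) /\<^sub>R norm (f z)) z"
  using assms(1)
proof (rule has_material_deriv_compose)
  fix X assume "((\<lambda>s. f (X s, s)) has_vector_derivative D) (at (snd z))" and z: "(X (snd z), snd z) = z"
  then show "((\<lambda>s. f (X s, s) /\<^sub>R norm (f (X s, s))) has_vector_derivative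
      (D - (sgn (f z) \<bullet> D) *\<^sub>R sgn (f z)) /\<^sub>R norm (f z)) (at (snd z))"
    using has_vector_derivative_sgn[of "\<lambda>s. f (X s, s)" D "snd z", unfolded z, OF _ assms(2)] by blast
qed

text \<open>The derivative is written as a quotient by the squared norm, hence as a ratio of inner
  products that can be differentiated once more.\<close>

lemma has_material_deriv_ln_norm:
  fixes f :: "point \<Rightarrow> 'b::real_inner"
  assumes "has_material_deriv u f D z" "f z \<noteq> 0"
  shows "has_material_deriv u (\<lambda>w. ln (norm (f w))) ((f z \<bullet> D) / (norm (f z))\<^sup>2) z"
  using has_material_deriv_norm[OF assms]
proof (rule has_material_deriv_compose)
  fix X assume "((\<lambda>s. norm (f (X s, s))) has_vector_derivative (sgn (f z) \<bullet> D)) (at (snd z))"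
    and z: "(X (snd z), snd z) = z"
  then have "((\<lambda>s. ln (norm (f (X s, s)))) has_real_derivative
      (sgn (f z) \<bullet> D) / norm (f (X (snd z), snd z))) (at (snd z))"
    unfolding has_real_derivative_iff_has_vector_derivative[symmetric]
    using assms(2) by (intro derivative_eq_intros) (auto simp: z divide_inverse_commute)
  then show "((\<lambda>s. ln (norm (f (X s, s)))) has_vector_derivative (f z \<bullet> D) / (norm (f z))\<^sup>2) (at (snd z))"
    by (simp add: z has_real_derivative_iff_has_vector_derivative sgn_div_norm divide_inverse power2_eq_square mult_ac)
qed

lemma materially_differentiableI:
  "has_material_deriv u f D z \<Longrightarrow> materially_differentiable u f z"
  unfolding materially_differentiable_def by blast

lemma double_sum_eq_inner_matrix_vector:
  fixes M :: "real^'n^'n" and v :: "real^'n"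
  shows "(\<Sum>i\<in>UNIV. \<Sum>j\<in>UNIV. M $ i $ j * v $ i * v $ j) = v \<bullet> (M *v v)"
  by (simp add: inner_vec_def matrix_vector_mult_def sum_distrib_left mult_ac)

lemma sgn_positive_scaleR:
  fixes v :: "'a::real_normed_vector"
  assumes "c > 0"
  shows "(c *\<^sub>R v) /\<^sub>R norm (c *\<^sub>R v) = v /\<^sub>R norm v"
  using assms by simp

text \<open>The definition normalizes S xi, whereas the transport identity concerns S omega. The two
  differ by the positive factor 1/|omega|; where omega vanishes both sides take the default value
  0.\<close>

lemma stretch_dir_eq:
  "stretch_dir u z = (strain u z *v curl u z) /\<^sub>R norm (strain u z *v curl u z)"
proof (cases "curl u z = 0")
  case True
  then show ?thesis by (simp add: stretch_dir_def vort_dir_def)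
next
  case False
  then show ?thesis
    using sgn_positive_scaleR[of "inverse (norm (curl u z))" "strain u z *v curl u z"]
    by (simp add: stretch_dir_def vort_dir_def matrix_vector_mult_scaleR)
qed

section \<open>Transport of omega and S omega, and the second derivative of log |omega|\<close>

context C1_euler
begin

text \<open>Linear in the d_i u, so derivatives along a trajectory pass through it.\<close>

lemma curl_eq:
  assumes "z \<in> spacetime T"
  shows "curl u z = (\<Sum>i\<in>UNIV. cross3 (axis i 1) (space_partial i u z))"
  by (simp add: curl_def space_partial_u_component[OF assms] vec_eq_iff forall_3 sum_3 cross3_def axis_def)

text \<open>The antisymmetric part of the velocity gradient annihilates the vorticity.\<close>

lemma strain_curl:
  assumes "z \<in> spacetime T"
  shows "strain u z *v curl u z = (\<Sum>k\<in>UNIV. (curl u z $ k) *\<^sub>R space_partial k u z)"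
  by (simp add: strain_def curl_def space_partial_u_component[OF assms] vec_eq_iff forall_3 sum_3
      matrix_vector_mult_def field_simps)

lemma divergence_free:
  assumes "z \<in> spacetime T"
  shows "space_partial 1 u z $ 1 + space_partial 2 u z $ 2 + space_partial 3 u z $ 3 = 0"
proof -
  have "divergence u z = 0" using euler assms unfolding euler_solution_def by blast
  then show ?thesis by (simp add: divergence_def space_partial_u_component[OF assms] sum_3)
qed

lemma has_material_derivI:
  assumes "z \<in> spacetime T"
    and "\<And>X. trajectory_through u z X \<Longrightarrow> ((\<lambda>s. f (X s, s)) has_vector_derivative D) (at (snd z))"
  shows "has_material_deriv u f D z"
  using assms ex_trajectory unfolding has_material_deriv_def by blast

lemma eventually_trajectory_in_spacetime:
  assumes "z \<in> spacetime T"
  shows "\<forall>\<^sub>F s in nhds (snd z). (X s, s) \<in> spacetime T"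
proof -
  have "\<forall>\<^sub>F s in nhds (snd z). s \<in> {0<..<T}"
    using assms by (intro eventually_nhds_in_open) (auto simp: spacetime_def)
  then show ?thesis by eventually_elim (simp add: spacetime_def)
qed

text \<open>Formulas such as \<open>curl_eq\<close> hold only inside the domain. Since the domain
  restricts time alone, every curve (X s, s) stays inside for s near the base time.\<close>

lemma has_material_deriv_cong:
  assumes z: "z \<in> spacetime T" and g: "has_material_deriv u g D z"
    and eq: "\<And>w. w \<in> spacetime T \<Longrightarrow> f w = g w"
  shows "has_material_deriv u f D z"
  using g
proof (rule has_material_deriv_compose)
  fix X assume g': "((\<lambda>s. g (X s, s)) has_vector_derivative D) (at (snd z))" "(X (snd z), snd z) = z"
  have "\<forall>\<^sub>F s in nhds (snd z). f (X s, s) = g (X s, s)"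
    using eventually_trajectory_in_spacetime[OF z] by eventually_elim (rule eq)
  from has_vector_derivative_at_cong[OF this] g'
  show "((\<lambda>s. f (X s, s)) has_vector_derivative D) (at (snd z))"
    by simp
qed

text \<open>With g_i = d_i u, the Hessian part, the sum of e_i x P_i, vanishes by symmetry. The
  quadratic part equals (omega . grad) u - (div u) omega, which is S omega by incompressibility and
  \<open>strain_curl\<close>.\<close>

lemma curl_material:
  assumes z: "z \<in> spacetime T"
  shows "has_material_deriv u (curl u) (strain u z *v curl u z) z"
proof (rule has_material_deriv_cong[OF z _ curl_eq], rule has_material_derivI[OF z])
  fix X assume X: "trajectory_through u z X"
  let ?g = "\<lambda>i. space_partial i u z"
  have "((\<lambda>s. \<Sum>i\<in>UNIV. cross3 (axis i 1) (space_partial i u (X s, s))) has_vector_derivative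
      (\<Sum>i\<in>UNIV. cross3 (axis i 1) (- (hessian p z $ i) - (\<Sum>k\<in>UNIV. (?g i $ k) *\<^sub>R ?g k)))) (at (snd z))"
    by (intro has_vector_derivative_sum bounded_linear.has_vector_derivative[OF bounded_linear_cross3]
        space_partial_u_along_trajectory[OF z X])
  moreover have "(\<Sum>i\<in>UNIV. cross3 (axis i 1) (- (hessian p z $ i) - (\<Sum>k\<in>UNIV. (?g i $ k) *\<^sub>R ?g k)))
      = strain u z *v curl u z"
  proof -
    \<comment> \<open>Incompressibility solved for one diagonal entry, so that what remains is a
      polynomial identity in independent entries.\<close>
    have tr: "?g 3 $ 3 = - ?g 1 $ 1 - ?g 2 $ 2" using divergence_free[OF z] by linarith
    note sym = hessian_symmetric[OF C1_p hessian_p z]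
    show ?thesis
      unfolding strain_curl[OF z]
      by (simp add: curl_def space_partial_u_component[OF z] vec_eq_iff forall_3 sum_3 cross3_def axis_def
          sym[of 2 1] sym[of 3 1] sym[of 3 2] tr algebra_simps)
  qed
  ultimately show "((\<lambda>s. \<Sum>i\<in>UNIV. cross3 (axis i 1) (space_partial i u (X s, s))) has_vector_derivative
      strain u z *v curl u z) (at (snd z))" by simp
qed

text \<open>By \<open>strain_curl\<close>, S omega is the sum of omega_k g_k with g_k = d_k u. The
  term from differentiating omega_k is (S omega)_k g_k, and it cancels the quadratic part of the
  equation for g_k, since (S omega)_l is the sum of omega_k g_{k,l}. Only - omega_k P_k survives,
  which sums to - P omega by symmetry.\<close>

lemma strain_curl_material:
  assumes z: "z \<in> spacetime T"
  shows "has_material_deriv u (\<lambda>w. strain u w *v curl u w) (- (hessian p z *v curl u z)) z"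
proof (rule has_material_deriv_cong[OF z _ strain_curl], rule has_material_derivI[OF z])
  fix X assume X: "trajectory_through u z X"
  let ?g = "\<lambda>i. space_partial i u z"
  have Xz: "(X (snd z), snd z) = z" by (rule trajectory_through_start[OF X])
  have dc: "((\<lambda>s. curl u (X s, s)) has_vector_derivative (strain u z *v curl u z)) (at (snd z))"
    using curl_material[OF z] X unfolding has_material_deriv_def by blast
  have "((\<lambda>s. \<Sum>k\<in>UNIV. (curl u (X s, s) $ k) *\<^sub>R space_partial k u (X s, s)) has_vector_derivative
      (\<Sum>k\<in>UNIV. (curl u (X (snd z), snd z) $ k) *\<^sub>R (- (hessian p z $ k) - (\<Sum>l\<in>UNIV. (?g k $ l) *\<^sub>R ?g l))
        + ((strain u z *v curl u z) $ k) *\<^sub>R space_partial k u (X (snd z), snd z))) (at (snd z))"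
    by (intro has_vector_derivative_sum bounded_bilinear.has_vector_derivative[OF bounded_bilinear_scaleR]
        bounded_linear.has_vector_derivative[OF bounded_linear_vec_nth] dc
        space_partial_u_along_trajectory[OF z X])
  moreover have "(\<Sum>k\<in>UNIV. (curl u z $ k) *\<^sub>R (- (hessian p z $ k) - (\<Sum>l\<in>UNIV. (?g k $ l) *\<^sub>R ?g l))
        + ((strain u z *v curl u z) $ k) *\<^sub>R ?g k) = - (hessian p z *v curl u z)"
  proof -
    note sym = hessian_symmetric[OF C1_p hessian_p z]
    show ?thesis
      unfolding strain_curl[OF z]
      by (simp add: vec_eq_iff forall_3 sum_3 matrix_vector_mult_def
          sym[of 2 1] sym[of 3 1] sym[of 3 2] algebra_simps)
  qed
  ultimately show "((\<lambda>s. \<Sum>k\<in>UNIV. (curl u (X s, s) $ k) *\<^sub>R space_partial k u (X s, s)) has_vector_derivative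
      - (hessian p z *v curl u z)) (at (snd z))" by (simp only: Xz)
qed

lemma material_deriv_ln_norm_curl:
  assumes "z \<in> spacetime T" "curl u z \<noteq> 0"
  shows "material_deriv u (\<lambda>w. ln (norm (curl u w))) z
    = (curl u z \<bullet> (strain u z *v curl u z)) / (curl u z \<bullet> curl u z)"
  using material_deriv_eqI[OF has_material_deriv_ln_norm[OF curl_material[OF assms(1)] assms(2)]]
  by (simp add: power2_norm_eq_inner)

text \<open>The first derivative is alpha = (omega . S omega) / |omega|^2, built only from vectors
  whose transport is known. The quotient rule gives (|S omega|^2 - omega . P omega) / |omega|^2 - 2
  (omega . S omega)^2 / |omega|^4.\<close>

lemma ln_norm_curl_material_twice:
  assumes z: "z \<in> spacetime T" and nz: "curl u z \<noteq> 0"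
  shows "has_material_deriv u (material_deriv u (\<lambda>w. ln (norm (curl u w))))
    ((norm (strain u z *v vort_dir u z))\<^sup>2 - 2 * (stretch_rate u z)\<^sup>2 - pressure_rate u p z) z"
proof (rule has_material_derivI[OF z])
  fix X assume X: "trajectory_through u z X"
  let ?o = "curl u z" and ?s = "strain u z *v curl u z" and ?P = "hessian p z *v curl u z"
  have Xz: "(X (snd z), snd z) = z" by (rule trajectory_through_start[OF X])
  have do: "((\<lambda>s. curl u (X s, s)) has_vector_derivative ?s) (at (snd z))"
    using curl_material[OF z] X unfolding has_material_deriv_def by blast
  have ds: "((\<lambda>s. strain u (X s, s) *v curl u (X s, s)) has_vector_derivative - ?P) (at (snd z))"
    using strain_curl_material[OF z] X unfolding has_material_deriv_def by blast
  \<comment> \<open>The formula for the first derivative requires omega to be nonzero, and the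
    second derivative needs it at all nearby times; continuity along X provides this.\<close>
  have "((\<lambda>s. curl u (X s, s)) \<longlongrightarrow> curl u (X (snd z), snd z)) (nhds (snd z))"
    using has_vector_derivative_continuous[OF do]
    unfolding isCont_def by (rule tendsto_at_iff_tendsto_nhds[THEN iffD1])
  from tendsto_imp_eventually_ne[OF this, of 0]
  have "\<forall>\<^sub>F s in nhds (snd z). curl u (X s, s) \<noteq> 0" using nz by (simp add: Xz)
  with eventually_trajectory_in_spacetime[OF z, of X]
  have ev: "\<forall>\<^sub>F s in nhds (snd z). material_deriv u (\<lambda>w. ln (norm (curl u w))) (X s, s)
      = (curl u (X s, s) \<bullet> (strain u (X s, s) *v curl u (X s, s))) / (curl u (X s, s) \<bullet> curl u (X s, s))"
    by eventually_elim (rule material_deriv_ln_norm_curl)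
  have "((\<lambda>s. curl u (X s, s) \<bullet> (strain u (X s, s) *v curl u (X s, s))) has_real_derivative
      (?o \<bullet> - ?P + ?s \<bullet> ?s)) (at (snd z))"
    using bounded_bilinear.has_vector_derivative[OF bounded_bilinear_inner do ds]
    unfolding has_real_derivative_iff_has_vector_derivative by (simp only: Xz)
  moreover have "((\<lambda>s. curl u (X s, s) \<bullet> curl u (X s, s)) has_real_derivative
      (?o \<bullet> ?s + ?s \<bullet> ?o)) (at (snd z))"
    using bounded_bilinear.has_vector_derivative[OF bounded_bilinear_inner do do]
    unfolding has_real_derivative_iff_has_vector_derivative by (simp only: Xz)
  ultimately have "((\<lambda>s. (curl u (X s, s) \<bullet> (strain u (X s, s) *v curl u (X s, s)))
        / (curl u (X s, s) \<bullet> curl u (X s, s))) has_real_derivative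
      ((?o \<bullet> - ?P + ?s \<bullet> ?s) * (?o \<bullet> ?o) - (?o \<bullet> ?s) * (?o \<bullet> ?s + ?s \<bullet> ?o)) / ((?o \<bullet> ?o) * (?o \<bullet> ?o))) (at (snd z))"
    using nz by (intro DERIV_divide[where f = "\<lambda>s. curl u (X s, s) \<bullet> (strain u (X s, s) *v curl u (X s, s))"
      and g = "\<lambda>s. curl u (X s, s) \<bullet> curl u (X s, s)" and x = "snd z", unfolded Xz]) auto
  moreover have "((?o \<bullet> - ?P + ?s \<bullet> ?s) * (?o \<bullet> ?o) - (?o \<bullet> ?s) * (?o \<bullet> ?s + ?s \<bullet> ?o)) / ((?o \<bullet> ?o) * (?o \<bullet> ?o))
      = (norm (strain u z *v vort_dir u z))\<^sup>2 - 2 * (stretch_rate u z)\<^sup>2 - pressure_rate u p z"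
  proof -
    define n where "n = norm ?o"
    have n: "n > 0" "?o \<bullet> ?o = n\<^sup>2" using nz by (auto simp: n_def dot_square_norm)
    have e1: "(norm (strain u z *v vort_dir u z))\<^sup>2 = (?s \<bullet> ?s) / n\<^sup>2"
      unfolding vort_dir_def n_def[symmetric] matrix_vector_mult_scaleR
      by (simp add: power_divide power_mult_distrib power2_norm_eq_inner divide_inverse power_inverse)
    have e2: "stretch_rate u z = (?o \<bullet> ?s) / n\<^sup>2"
      unfolding stretch_rate_def double_sum_eq_inner_matrix_vector vort_dir_def n_def[symmetric] matrix_vector_mult_scaleR
      by (simp add: power2_eq_square divide_inverse)
    have e3: "pressure_rate u p z = (?o \<bullet> ?P) / n\<^sup>2"
      unfolding pressure_rate_def double_sum_eq_inner_matrix_vector vort_dir_def n_def[symmetric] matrix_vector_mult_scaleR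
      by (simp add: power2_eq_square divide_inverse)
    show ?thesis
      unfolding e1 e2 e3 n(2) inner_commute[of ?s ?o]
      using n(1) by (simp add: field_simps power2_eq_square)
  qed
  ultimately have "((\<lambda>s. (curl u (X s, s) \<bullet> (strain u (X s, s) *v curl u (X s, s)))
        / (curl u (X s, s) \<bullet> curl u (X s, s))) has_vector_derivative
      (norm (strain u z *v vort_dir u z))\<^sup>2 - 2 * (stretch_rate u z)\<^sup>2 - pressure_rate u p z) (at (snd z))"
    by (simp add: has_real_derivative_iff_has_vector_derivative)
  then show "((\<lambda>s. material_deriv u (\<lambda>w. ln (norm (curl u w))) (X s, s)) has_vector_derivative
      (norm (strain u z *v vort_dir u z))\<^sup>2 - 2 * (stretch_rate u z)\<^sup>2 - pressure_rate u p z) (at (snd z))"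
    by (rule has_vector_derivative_at_cong[THEN iffD2, OF ev])
qed

end

theorem proposition1p1:
  fixes u :: "(real^3) \<times> real \<Rightarrow> real^3" and p :: "(real^3) \<times> real \<Rightarrow> real" and T :: real
  assumes "C1_on (spacetime T) u"
    and "C1_on (spacetime T) p"
    and "continuous_hessian_on (spacetime T) p"
    and "euler_solution T u p"
  shows "\<forall>z\<in>spacetime T.
    (curl u z \<noteq> 0 \<longrightarrow>
       materially_differentiable u (\<lambda>w. norm (curl u w)) z \<and>
       materially_differentiable u (vort_dir u) z \<and>
       materially_differentiable u (\<lambda>w. ln (norm (curl u w))) z \<and>
       materially_differentiable u (material_deriv u (\<lambda>w. ln (norm (curl u w)))) z \<and>
       material_deriv u (material_deriv u (\<lambda>w. ln (norm (curl u w)))) z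
         = (norm (strain u z *v vort_dir u z))\<^sup>2 - 2 * (stretch_rate u z)\<^sup>2 - pressure_rate u p z \<and>
       (material_deriv u (\<lambda>w. norm (curl u w)) z)\<^sup>2
         + (norm (material_deriv u (vort_dir u) z) * norm (curl u z))\<^sup>2
         = (norm (strain u z *v curl u z))\<^sup>2) \<and>
    (strain u z *v curl u z \<noteq> 0 \<longrightarrow>
       materially_differentiable u (\<lambda>w. norm (strain u w *v curl u w)) z \<and>
       materially_differentiable u (stretch_dir u) z \<and>
       material_deriv u (\<lambda>w. norm (strain u w *v curl u w)) z
         = - (stretch_dir u z \<bullet> (hessian p z *v curl u z)) \<and>
       (material_deriv u (\<lambda>w. norm (strain u w *v curl u w)) z)\<^sup>2
         + (norm (material_deriv u (stretch_dir u) z) * norm (strain u z *v curl u z))\<^sup>2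
         = (norm (hessian p z *v curl u z))\<^sup>2 \<and>
       (material_deriv u (\<lambda>w. norm (strain u w *v curl u w)) z)\<^sup>2
         + (norm (material_deriv u (stretch_dir u) z)
              * material_deriv u (\<lambda>w. norm (curl u w)) z)\<^sup>2
         + (norm (material_deriv u (stretch_dir u) z)
              * norm (material_deriv u (vort_dir u) z) * norm (curl u z))\<^sup>2
         = (norm (hessian p z *v curl u z))\<^sup>2)"
proof -
  from assms(1) obtain Du :: "point \<Rightarrow> point \<Rightarrow>\<^sub>L (real^3)"
    where "\<And>z. z \<in> spacetime T \<Longrightarrow> (u has_derivative blinfun_apply (Du z)) (at z)"
      and "continuous_on (spacetime T) Du"
    unfolding C1_on_def by blast
  with assms(2-4) interpret C1_euler u p T Du by unfold_locales
  have "vort_dir u = (\<lambda>w. curl u w /\<^sub>R norm (curl u w))"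
    and str: "stretch_dir u = (\<lambda>w. (strain u w *v curl u w) /\<^sub>R norm (strain u w *v curl u w))"
    by (simp_all add: fun_eq_iff vort_dir_def stretch_dir_eq)
  note dirs = this
  show ?thesis
  proof (intro ballI)
    fix z assume z: "z \<in> spacetime T"
    let ?o = "curl u z" and ?s = "strain u z *v curl u z" and ?P = "hessian p z *v curl u z"
    note norm_curl = has_material_deriv_norm[OF curl_material[OF z]]
    note vort = has_material_deriv_sgn[OF curl_material[OF z], folded dirs]
    note norm_stretch = has_material_deriv_norm[OF strain_curl_material[OF z]]
    note stretch = has_material_deriv_sgn[OF strain_curl_material[OF z], folded dirs]
    have vorticity: "(material_deriv u (\<lambda>w. norm (curl u w)) z)\<^sup>2
        + (norm (material_deriv u (vort_dir u) z) * norm ?o)\<^sup>2 = (norm ?s)\<^sup>2" if "?o \<noteq> 0"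
      unfolding material_deriv_eqI[OF norm_curl[OF that]] material_deriv_eqI[OF vort[OF that]]
      by (rule norm_sgn_derivative_pythagoras[OF that])
    have stretching: "(material_deriv u (\<lambda>w. norm (strain u w *v curl u w)) z)\<^sup>2
        + (norm (material_deriv u (stretch_dir u) z) * norm ?s)\<^sup>2 = (norm ?P)\<^sup>2" if "?s \<noteq> 0"
      unfolding material_deriv_eqI[OF norm_stretch[OF that]] material_deriv_eqI[OF stretch[OF that]]
      using norm_sgn_derivative_pythagoras[OF that, of "- ?P"] by simp
    have combined: "(material_deriv u (\<lambda>w. norm (strain u w *v curl u w)) z)\<^sup>2
         + (norm (material_deriv u (stretch_dir u) z) * material_deriv u (\<lambda>w. norm (curl u w)) z)\<^sup>2
         + (norm (material_deriv u (stretch_dir u) z)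
              * norm (material_deriv u (vort_dir u) z) * norm ?o)\<^sup>2 = (norm ?P)\<^sup>2" if "?s \<noteq> 0"
    proof -
      \<comment> \<open>S 0 = 0, so the vorticity identity is available; its left side is
        substituted for |S omega|^2 in the stretching identity.\<close>
      have "?o \<noteq> 0" using that by auto
      from stretching[OF that] vorticity[OF this, symmetric] show ?thesis
        by (simp add: power_mult_distrib distrib_left mult.assoc)
    qed
    have rate: "material_deriv u (\<lambda>w. norm (strain u w *v curl u w)) z = - (stretch_dir u z \<bullet> ?P)" if "?s \<noteq> 0"
      unfolding material_deriv_eqI[OF norm_stretch[OF that]] by (simp add: str sgn_div_norm)
    note norm_curl[THEN materially_differentiableI] vort[THEN materially_differentiableI]
      has_material_deriv_ln_norm[OF curl_material[OF z], THEN materially_differentiableI]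
      ln_norm_curl_material_twice[OF z, THEN materially_differentiableI]
      norm_stretch[THEN materially_differentiableI] stretch[THEN materially_differentiableI]
      vorticity stretching combined rate ln_norm_curl_material_twice[OF z, THEN material_deriv_eqI]
    note rules = this
    show "(?o \<noteq> 0 \<longrightarrow>
       materially_differentiable u (\<lambda>w. norm (curl u w)) z \<and>
       materially_differentiable u (vort_dir u) z \<and>
       materially_differentiable u (\<lambda>w. ln (norm (curl u w))) z \<and>
       materially_differentiable u (material_deriv u (\<lambda>w. ln (norm (curl u w)))) z \<and>
       material_deriv u (material_deriv u (\<lambda>w. ln (norm (curl u w)))) z
         = (norm (strain u z *v vort_dir u z))\<^sup>2 - 2 * (stretch_rate u z)\<^sup>2 - pressure_rate u p z \<and>
       (material_deriv u (\<lambda>w. norm (curl u w)) z)\<^sup>2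
         + (norm (material_deriv u (vort_dir u) z) * norm ?o)\<^sup>2 = (norm ?s)\<^sup>2) \<and>
    (?s \<noteq> 0 \<longrightarrow>
       materially_differentiable u (\<lambda>w. norm (strain u w *v curl u w)) z \<and>
       materially_differentiable u (stretch_dir u) z \<and>
       material_deriv u (\<lambda>w. norm (strain u w *v curl u w)) z = - (stretch_dir u z \<bullet> ?P) \<and>
       (material_deriv u (\<lambda>w. norm (strain u w *v curl u w)) z)\<^sup>2
         + (norm (material_deriv u (stretch_dir u) z) * norm ?s)\<^sup>2 = (norm ?P)\<^sup>2 \<and>
       (material_deriv u (\<lambda>w. norm (strain u w *v curl u w)) z)\<^sup>2
         + (norm (material_deriv u (stretch_dir u) z) * material_deriv u (\<lambda>w. norm (curl u w)) z)\<^sup>2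
         + (norm (material_deriv u (stretch_dir u) z)
              * norm (material_deriv u (vort_dir u) z) * norm ?o)\<^sup>2 = (norm ?P)\<^sup>2)"
      by (intro conjI impI; rule rules; assumption)
  qed
qed

end
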